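(* Let $T=(\mathcal V,\mathcal E)$ be an $\mathbb R^n$-refinement tree and $\Phi=[\phi_1\ \cdots\ \phi_{p_0}]\in\mathbb R^{n\times p_0}$ the initial basis (of full column rank), and let $V^{(0)},V^{(1)},V^{(2)},\ldots$ be the successive refined bases produced by the iterations of the refinement algorithm described in the context. Then their ranges form a monotone sequence of embedded subspaces: $$\mathrm{range}(V^{(i-1)})\subset\mathrm{range}(V^{(i)})\qquad\text{for every iteration } i\ge 1 .$$
   Context: **Orthogonal decompositions.** $\mathbb R^n$ carries the Euclidean inner product; $P_{\mathbb U}$ is the orthogonal projection onto a subspace $\mathbb U$. An orthogonal decomposition of an inner-product space $\mathbb V$ is a finite set $\{\mathbb U_1,\ldots,\mathbb U_m\}$ of nontrivial (nonzero) subspaces of $\mathbb V$ that are pairwise orthogonal and sum to $\mathbb V$. The symbol $\subset$ allows equality. **Refinement tree.** An $\mathbb R^n$-refinement tree $T=(\mathcal V,\mathcal E)$ is a finite rooted tree (directed acyclic graph in which every vertex has in-degree one except a unique root of in-degree zero) whose vertices are subspaces of $\mathbb R^n$ such that: the root is $\mathbb R^n$; for every non-leaf vertex $\mathbb U$ the set $C_T(\mathbb U)$ of its children is an orthogonal decomposition of $\mathbb U$; every leaf (vertex without children) has dimension one. $\mathcal L$ is the set of leaves. A frontier of $T$ is an orthogonal decomposition $\mathcal F$ of $\mathbb R^n$ with $\mathcal F\subset\mathcal V$. The $T$-refinement of a vertex is $R_T(\mathbb U)=C_T(\mathbb U)$ if $\mathbb U$ is not a leaf and $R_T(\mathbb U)=\{\mathbb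 U\}$ if it is. **Algorithm.** Given: a residual $r:\mathbb R^n\to\mathbb R^n$ and a quantity-of-interest functional $g:\mathbb R^n\to\mathbb R$, both twice continuously differentiable; a reference state $\bar x\in\mathbb R^n$; the full-column-rank initial basis $\Phi=[\phi_1\cdots\phi_{p_0}]$; a tolerance $\varepsilon>0$; and initial frontiers $\mathcal F_1,\ldots,\mathcal F_{p_0}$ of $T$ (by default $\mathcal F_i=\{\mathbb R^n\}$). The algorithm repeats the following iteration. 1. Form the refined basis $V$, the matrix whose columns are $v_{(i,\mathbb U)}=P_{\mathbb U}(\phi_i)$, indexed by the disjoint union $\bar{\mathcal F}^H=\{(i,\mathbb U): 1\le i\le p_0,\ \mathbb U\in\mathcal F_i\}$. 2. Compute a reduced solution $\hat x$ of $V^T r(\bar x+V\hat x)=0$ (up to a prescribed reduced-order-model tolerance), and set $x=\bar x+V\hat x$. 3. If $\|r(x)\|_2<\varepsilon$, stop. 4. Otherwise compute the coarse adjoint $\hat y\in\mathbb R^{\bar{\mathcal F}^H}$ solving $[V^T\frac{\partial r}{\partial x}(x)V]^T\hat y=V^T\frac{\partial g}{\partial x}(x)^T$. For each $(i,\mathbb U)\in\bar{\mathcal F}^H$ and $\mathbb W\in R_T(\mathbb U)$ set the fine error indicator $\delta^h_{(i,\mathbb W)}=\left|\hat y_{(i,\mathbb U)}\,P_{\mathbb W}(\phi_i)^T r(x)\right|$ if $\mathbb W\notin\mathcal L$, and $\delta^h_{(i,\mathbb W)}=0$ if $\mathbb W\in\mathcal L$. Set the coarse error indicator $\delta^H_{(i,\mathbb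 U)}=\sum_{\mathbb W\in R_T(\mathbb U)}\delta^h_{(i,\mathbb W)}$. 5. Let $\eta$ be the average of $\delta^H$ over $\bar{\mathcal F}^H$ and $S_i=\{\mathbb U\in\mathcal F_i:\delta^H_{(i,\mathbb U)}\ge\eta\}$. Replace each $\mathcal F_i$ by its partial refinement $(\mathcal F_i\setminus S_i)\cup\bigcup_{\mathbb U\in S_i}R_T(\mathbb U)$ and return to step 1. It is understood that the computations in steps 2 and 4 can be carried out (i.e. they return some vectors $\hat x$, $\hat y$) at every iteration performed. $V^{(i)}$ denotes the matrix $V$ formed in step 1 of iteration $i$. *)

theory Defs
  imports "HOL-Analysis.Analysis"
begin

definition twice_continuously_differentiable ::
  "('a::real_normed_vector \<Rightarrow> 'b::real_normed_vector) \<Rightarrow> bool" where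
  "twice_continuously_differentiable f \<longleftrightarrow>
     (\<exists>(f' :: 'a \<Rightarrow> 'a \<Rightarrow>\<^sub>L 'b) (f'' :: 'a \<Rightarrow> 'a \<Rightarrow>\<^sub>L 'a \<Rightarrow>\<^sub>L 'b).
        (\<forall>x. (f has_derivative blinfun_apply (f' x)) (at x)) \<and>
        (\<forall>x. (f' has_derivative blinfun_apply (f'' x)) (at x)) \<and>
        continuous_on UNIV f'')"

definition gradient :: "('a::real_inner \<Rightarrow> real) \<Rightarrow> 'a \<Rightarrow> 'a" where
  "gradient g x = (THE D. GDERIV g x :> D)"

definition orth_proj :: "'a::euclidean_space set \<Rightarrow> 'a \<Rightarrow> 'a" where
  "orth_proj U x = (THE p. p \<in> U \<and> (\<forall>u\<in>U. orthogonal (x - p) u))"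

definition orthogonal_decomposition ::
  "'a::euclidean_space set \<Rightarrow> 'a set set \<Rightarrow> bool" where
  "orthogonal_decomposition V D \<longleftrightarrow>
     finite D \<and>
     (\<forall>U\<in>D. subspace U \<and> U \<subseteq> V \<and> U \<noteq> {0}) \<and>
     pairwise (\<lambda>U W. \<forall>u\<in>U. \<forall>w\<in>W. orthogonal u w) D \<and>
     {\<Sum>U\<in>D. s U | s. \<forall>U\<in>D. s U \<in> U} = V"


section \<open>Refinement trees\<close>

text \<open>A graph is given by its vertex set and its edge relation; an edge points from a
  vertex to its child.\<close>

definition children :: "('v \<times> 'v) set \<Rightarrow> 'v \<Rightarrow> 'v set" where
  "children E U = {W. (U, W) \<in> E}"

definition leaves :: "'v set \<Rightarrow> ('v \<times> 'v) set \<Rightarrow> 'v set" where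
  "leaves Vs E = {U \<in> Vs. children E U = {}}"

definition rooted_tree :: "'v set \<Rightarrow> ('v \<times> 'v) set \<Rightarrow> 'v \<Rightarrow> bool" where
  "rooted_tree Vs E rt \<longleftrightarrow>
     finite Vs \<and> E \<subseteq> Vs \<times> Vs \<and> acyclic E \<and> rt \<in> Vs \<and>
     (\<forall>U\<in>Vs. card {W. (W, U) \<in> E} = (if U = rt then 0 else 1))"

definition refinement_tree ::
  "'a::euclidean_space set set \<Rightarrow> ('a set \<times> 'a set) set \<Rightarrow> bool" where
  "refinement_tree Vs E \<longleftrightarrow>
     rooted_tree Vs E UNIV \<and>
     (\<forall>U\<in>Vs. subspace U) \<and>
     (\<forall>U\<in>Vs - leaves Vs E. orthogonal_decomposition U (children E U)) \<and>
     (\<forall>U\<in>leaves Vs E. dim U = 1)"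

definition tree_frontier :: "'a::euclidean_space set set \<Rightarrow> 'a set set \<Rightarrow> bool" where
  "tree_frontier Vs F \<longleftrightarrow> orthogonal_decomposition UNIV F \<and> F \<subseteq> Vs"

definition tree_refinement :: "'v set \<Rightarrow> ('v \<times> 'v) set \<Rightarrow> 'v \<Rightarrow> 'v set" where
  "tree_refinement Vs E U = (if U \<in> leaves Vs E then {U} else children E U)"


section \<open>The refined basis\<close>

text \<open>The number of columns of the refined basis changes from one iteration to the next, so
  its columns are indexed by the finite set \<open>index_set F\<close> and not by a type. Coefficient
  vectors such as \<open>xhat\<close> and \<open>yhat\<close> are functions of which only the values on
  \<open>index_set F\<close> are used.\<close>

definition index_set :: "('p \<Rightarrow> 'v set) \<Rightarrow> ('p \<times> 'v) set" where
  "index_set F = {(i, U). U \<in> F i}"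

definition basis_col ::
  "real^'p^'n \<Rightarrow> 'p \<times> (real^'n) set \<Rightarrow> real^'n" where
  "basis_col Phi = (\<lambda>(i, U). orth_proj U (column i Phi))"

text \<open>\<open>V c\<close>, for the matrix \<open>V\<close> with columns \<open>basis_col Phi k\<close>,
  \<open>k \<in> index_set F\<close>.\<close>

definition basis_mult ::
  "real^'p^'n \<Rightarrow> ('p \<Rightarrow> (real^'n) set set) \<Rightarrow>
   ('p \<times> (real^'n) set \<Rightarrow> real) \<Rightarrow> real^'n" where
  "basis_mult Phi F c = (\<Sum>k\<in>index_set F. c k *\<^sub>R basis_col Phi k)"

definition basis_range ::
  "real^'p^'n \<Rightarrow> ('p \<Rightarrow> (real^'n) set set) \<Rightarrow> (real^'n) set" where
  "basis_range Phi F = range (basis_mult Phi F)"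


section \<open>The steps of the algorithm\<close>

text \<open>The Euclidean norm of \<open>V\<^sup>T r(xbar + V xhat)\<close> is at most the tolerance \<open>tol\<close> of
  the reduced-order model; for \<open>tol = 0\<close> the equation holds exactly.\<close>

definition reduced_solution ::
  "(real^'n \<Rightarrow> real^'n) \<Rightarrow> real^'n \<Rightarrow> real^'p^'n \<Rightarrow> real \<Rightarrow>
   ('p \<Rightarrow> (real^'n) set set) \<Rightarrow> ('p \<times> (real^'n) set \<Rightarrow> real) \<Rightarrow> bool" where
  "reduced_solution r xbar Phi tol F xhat \<longleftrightarrow>
     L2_set (\<lambda>k. basis_col Phi k \<bullet> r (xbar + basis_mult Phi F xhat)) (index_set F) \<le> tol"

text \<open>The equation \<open>(V\<^sup>T J V)\<^sup>T yhat = V\<^sup>T (\<partial>g/\<partial>x)\<^sup>T\<close>, row by row, where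
  \<open>J\<close> is the Jacobian of \<open>r\<close> at \<open>x\<close>. The entry of \<open>V\<^sup>T J V\<close> in row
  \<open>l\<close> and column \<open>k\<close> is \<open>v\<^sub>l \<bullet> J v\<^sub>k\<close>.\<close>

definition coarse_adjoint ::
  "(real^'n \<Rightarrow> real^'n) \<Rightarrow> (real^'n \<Rightarrow> real) \<Rightarrow> real^'p^'n \<Rightarrow>
   ('p \<Rightarrow> (real^'n) set set) \<Rightarrow> real^'n \<Rightarrow> ('p \<times> (real^'n) set \<Rightarrow> real) \<Rightarrow> bool" where
  "coarse_adjoint r g Phi F x yhat \<longleftrightarrow>
     (\<forall>k\<in>index_set F.
        (\<Sum>l\<in>index_set F.
           (basis_col Phi l \<bullet> (jacobian r (at x) *v basis_col Phi k)) * yhat l)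
        = basis_col Phi k \<bullet> gradient g x)"

text \<open>The indicator of \<open>(i, W)\<close> also takes the frontier element \<open>U\<close> with
  \<open>W \<in> R\<^sub>T(U)\<close> as an argument.\<close>

definition fine_indicator ::
  "(real^'n \<Rightarrow> real^'n) \<Rightarrow> (real^'n) set set \<Rightarrow> ((real^'n) set \<times> (real^'n) set) set \<Rightarrow>
   real^'p^'n \<Rightarrow> real^'n \<Rightarrow> ('p \<times> (real^'n) set \<Rightarrow> real) \<Rightarrow>
   'p \<Rightarrow> (real^'n) set \<Rightarrow> (real^'n) set \<Rightarrow> real" where
  "fine_indicator r Vs E Phi x yhat i U W =
     (if W \<in> leaves Vs E then 0
      else \<bar>yhat (i, U) * (orth_proj W (column i Phi) \<bullet> r x)\<bar>)"

definition coarse_indicator ::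
  "(real^'n \<Rightarrow> real^'n) \<Rightarrow> (real^'n) set set \<Rightarrow> ((real^'n) set \<times> (real^'n) set) set \<Rightarrow>
   real^'p^'n \<Rightarrow> real^'n \<Rightarrow> ('p \<times> (real^'n) set \<Rightarrow> real) \<Rightarrow>
   'p \<times> (real^'n) set \<Rightarrow> real" where
  "coarse_indicator r Vs E Phi x yhat =
     (\<lambda>(i, U). \<Sum>W\<in>tree_refinement Vs E U. fine_indicator r Vs E Phi x yhat i U W)"

definition average :: "('k \<Rightarrow> real) \<Rightarrow> 'k set \<Rightarrow> real" where
  "average d K = (\<Sum>k\<in>K. d k) / real (card K)"

definition marked ::
  "('p \<times> 'v \<Rightarrow> real) \<Rightarrow> ('p \<Rightarrow> 'v set) \<Rightarrow> 'p \<Rightarrow> 'v set" where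
  "marked d F i = {U \<in> F i. d (i, U) \<ge> average d (index_set F)}"

definition partial_refinement ::
  "'v set \<Rightarrow> ('v \<times> 'v) set \<Rightarrow> 'v set \<Rightarrow> 'v set \<Rightarrow> 'v set" where
  "partial_refinement Vs E F S = (F - S) \<union> (\<Union>U\<in>S. tree_refinement Vs E U)"


section \<open>Runs of the algorithm\<close>

definition state ::
  "real^'n \<Rightarrow> real^'p^'n \<Rightarrow> (nat \<Rightarrow> 'p \<Rightarrow> (real^'n) set set) \<Rightarrow>
   (nat \<Rightarrow> 'p \<times> (real^'n) set \<Rightarrow> real) \<Rightarrow> nat \<Rightarrow> real^'n" where
  "state xbar Phi F xhat k = xbar + basis_mult Phi (F k) (xhat k)"

text \<open>Iteration \<open>k\<close> is performed iff no earlier iteration has stopped the algorithm. The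
  entries of the sequences \<open>F\<close>, \<open>xhat\<close> and \<open>yhat\<close> beyond a stop are
  unconstrained.\<close>

definition performed ::
  "(real^'n \<Rightarrow> real^'n) \<Rightarrow> real^'n \<Rightarrow> real^'p^'n \<Rightarrow> real \<Rightarrow>
   (nat \<Rightarrow> 'p \<Rightarrow> (real^'n) set set) \<Rightarrow> (nat \<Rightarrow> 'p \<times> (real^'n) set \<Rightarrow> real) \<Rightarrow>
   nat \<Rightarrow> bool" where
  "performed r xbar Phi eps F xhat k \<longleftrightarrow>
     (\<forall>j<k. \<not> norm (r (state xbar Phi F xhat j)) < eps)"

definition algorithm_run ::
  "(real^'n) set set \<Rightarrow> ((real^'n) set \<times> (real^'n) set) set \<Rightarrow>
   (real^'n \<Rightarrow> real^'n) \<Rightarrow> (real^'n \<Rightarrow> real) \<Rightarrow> real^'n \<Rightarrow> real^'p^'n \<Rightarrow>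
   real \<Rightarrow> real \<Rightarrow> ('p \<Rightarrow> (real^'n) set set) \<Rightarrow>
   (nat \<Rightarrow> 'p \<Rightarrow> (real^'n) set set) \<Rightarrow>
   (nat \<Rightarrow> 'p \<times> (real^'n) set \<Rightarrow> real) \<Rightarrow>
   (nat \<Rightarrow> 'p \<times> (real^'n) set \<Rightarrow> real) \<Rightarrow> bool" where
  "algorithm_run Vs E r g xbar Phi eps tol F0 F xhat yhat \<longleftrightarrow>
     F 0 = F0 \<and>
     (\<forall>k. performed r xbar Phi eps F xhat k \<longrightarrow>
        reduced_solution r xbar Phi tol (F k) (xhat k) \<and>
        (let x = state xbar Phi F xhat k;
             d = coarse_indicator r Vs E Phi x (yhat k)
         in \<not> norm (r x) < eps \<longrightarrow>
              coarse_adjoint r g Phi (F k) x (yhat k) \<and>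
              (\<forall>i. F (Suc k) i =
                   partial_refinement Vs E (F k i) (marked d (F k) i))))"

end

theory Submission
  imports Defs
begin

text \<open>For an orthogonal decomposition \<open>D\<close> of \<open>U\<close> one has
  \<open>P\<^sub>U = (\<Sum>W\<in>D. P\<^sub>W)\<close>. Hence a column \<open>P\<^sub>U \<phi>\<^sub>i\<close> that is split by the
  refinement is the sum of the columns replacing it. All frontiers stay inside the finite vertex
  set of the tree, so the ranges are the spans of finitely many columns.\<close>

text \<open>Two vectors of \<open>U\<close> whose residuals from \<open>x\<close> are both
  orthogonal to \<open>U\<close> differ by an element of \<open>U\<close> that is orthogonal to
  itself, hence zero. This uniqueness lets the definite description in \<open>orth_proj\<close> be
  evaluated.\<close>

lemma orth_proj_eqI:
  assumes "subspace U" "p \<in> U" "\<And>u. u \<in> U \<Longrightarrow> orthogonal (x - p) u"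
  shows "orth_proj U x = p"
  unfolding orth_proj_def
proof (rule the_equality)
  fix q assume q: "q \<in> U \<and> (\<forall>u\<in>U. orthogonal (x - q) u)"
  have "p - q \<in> U"
    using assms q by (simp add: subspace_diff)
  then have "(x - q) \<bullet> (p - q) - (x - p) \<bullet> (p - q) = 0"
    using assms(3) q by (simp add: orthogonal_def)
  then have "(p - q) \<bullet> (p - q) = 0"
    by (simp add: inner_diff_left)
  then show "q = p" by simp
qed (use assms in auto)

text \<open>Existence comes from splitting \<open>x\<close> into a part in \<open>span U\<close> and
  a part orthogonal to it. From here on \<open>orth_proj\<close> is handled through these two
  properties and \<open>orth_proj_eqI\<close>, without unfolding its definition.\<close>

lemma orth_proj:
  assumes "subspace U"
  shows orth_proj_in: "orth_proj U x \<in> U"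
    and orth_proj_orthogonal: "u \<in> U \<Longrightarrow> orthogonal (x - orth_proj U x) u"
proof -
  obtain y z where yz: "y \<in> span U" "\<And>w. w \<in> span U \<Longrightarrow> orthogonal z w" "x = y + z"
    using orthogonal_subspace_decomp_exists[of U x] by blast
  moreover have "span U = U"
    using assms by (simp add: span_eq_iff)
  ultimately have y: "y \<in> U" "\<And>u. u \<in> U \<Longrightarrow> orthogonal (x - y) u"
    by auto
  then have "orth_proj U x = y"
    by (rule orth_proj_eqI[OF assms])
  with y show "orth_proj U x \<in> U" "u \<in> U \<Longrightarrow> orthogonal (x - orth_proj U x) u"
    by auto
qed

lemma orth_proj_orthogonal_decomposition:
  assumes "subspace U" "orthogonal_decomposition U D"
  shows "orth_proj U x = (\<Sum>W\<in>D. orth_proj W x)"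
proof (rule orth_proj_eqI[OF assms(1)])
  have fin: "finite D" and sub: "\<And>W. W \<in> D \<Longrightarrow> subspace W \<and> W \<subseteq> U"
    and orth: "\<And>W W' u w. W \<in> D \<Longrightarrow> W' \<in> D \<Longrightarrow> W \<noteq> W' \<Longrightarrow> u \<in> W \<Longrightarrow> w \<in> W' \<Longrightarrow> orthogonal u w"
    and sums: "{\<Sum>U\<in>D. s U | s. \<forall>U\<in>D. s U \<in> U} = U"
    using assms(2) by (simp_all add: orthogonal_decomposition_def pairwise_def)
  show "(\<Sum>W\<in>D. orth_proj W x) \<in> U"
    using assms(1)
  proof (rule subspace_sum)
    fix W assume "W \<in> D"
    then show "orth_proj W x \<in> U"
      using sub[of W] orth_proj_in[of W x] by blast
  qed
  fix u assume "u \<in> U"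
  \<comment> \<open>The members of \<open>D\<close> sum to \<open>U\<close>, so by linearity it
    suffices to test the residual against one component \<open>s W\<close> at a time.\<close>
  then obtain s where u: "u = (\<Sum>W\<in>D. s W)" and s: "\<And>W. W \<in> D \<Longrightarrow> s W \<in> W"
    using sums by blast
  have "orthogonal (x - (\<Sum>W\<in>D. orth_proj W x)) (s W)" if W: "W \<in> D" for W
  proof -
    have "orth_proj W' x \<bullet> s W = 0" if "W' \<in> D - {W}" for W'
      using orth[of W' W "orth_proj W' x" "s W"] W s[OF W] that orth_proj_in[of W' x] sub[of W']
      by (simp add: orthogonal_def)
    then have "(\<Sum>W'\<in>D - {W}. orth_proj W' x \<bullet> s W) = 0"
      by (intro sum.neutral) blast
    \<comment> \<open>Pairwise orthogonality leaves only the summand of \<open>W\<close>, and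
      against vectors of \<open>W\<close> that projection acts like \<open>x\<close> itself.\<close>
    then have "(\<Sum>W'\<in>D. orth_proj W' x) \<bullet> s W = orth_proj W x \<bullet> s W"
      unfolding inner_sum_left by (subst sum.remove[OF fin W]) linarith
    moreover have "x \<bullet> s W = orth_proj W x \<bullet> s W"
      using orth_proj_orthogonal[of W "s W" x] sub W s
      by (simp add: orthogonal_def inner_diff_left)
    ultimately show ?thesis
      by (simp add: orthogonal_def inner_diff_left)
  qed
  then show "orthogonal (x - (\<Sum>W\<in>D. orth_proj W x)) u"
    by (simp add: u orthogonal_def inner_sum_right)
qed

text \<open>A leaf is its own refinement, so the sum has the single term
  \<open>orth_proj U x\<close>; at any other vertex the children form an orthogonal
  decomposition.\<close>

lemma refinement_tree_refinement:
  assumes "refinement_tree Vs E" "U \<in> Vs"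
  shows tree_refinement_subset: "tree_refinement Vs E U \<subseteq> Vs"
    and orth_proj_tree_refinement:
      "orth_proj U x = (\<Sum>W\<in>tree_refinement Vs E U. orth_proj W x)"
proof -
  show "tree_refinement Vs E U \<subseteq> Vs"
    using assms unfolding refinement_tree_def rooted_tree_def tree_refinement_def children_def
    by auto
  have "subspace U" "U \<notin> leaves Vs E \<Longrightarrow> orthogonal_decomposition U (children E U)"
    using assms by (simp_all add: refinement_tree_def)
  then show "orth_proj U x = (\<Sum>W\<in>tree_refinement Vs E U. orth_proj W x)"
    by (simp add: tree_refinement_def orth_proj_orthogonal_decomposition)
qed

lemma finite_index_set:
  fixes F :: "'p::finite \<Rightarrow> 'v set"
  assumes "\<And>i. finite (F i)"
  shows "finite (index_set F)"
proof -
  have "index_set F = Sigma UNIV F"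
    by (auto simp: index_set_def)
  then show ?thesis
    using assms by simp
qed

text \<open>In span form, an inclusion of ranges can be checked column by column. Finiteness matters
  because a sum over an infinite index set would be 0 by convention.\<close>

lemma basis_range_eq_span:
  assumes "finite (index_set F)"
  shows "basis_range Phi F = span (basis_col Phi ` index_set F)"
proof
  have "basis_mult Phi F c \<in> span (basis_col Phi ` index_set F)" for c
    unfolding basis_mult_def by (intro span_sum span_scale span_base imageI)
  then show "basis_range Phi F \<subseteq> span (basis_col Phi ` index_set F)"
    by (auto simp: basis_range_def)
  \<comment> \<open>The unit coefficient vector at \<open>k\<close> picks out one column.\<close>
  have "basis_mult Phi F (\<lambda>l. if l = k then 1 else 0) = basis_col Phi k"
    if "k \<in> index_set F" for k
    using assms that by (simp add: basis_mult_def if_distrib[of "\<lambda>c. c *\<^sub>R _"] cong: if_cong)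
  then have "basis_col Phi ` index_set F \<subseteq> basis_range Phi F"
    unfolding basis_range_def by (metis image_subsetI rangeI)
  moreover have "subspace (basis_range Phi F)"
  proof (rule subspaceI)
    have "basis_mult Phi F (\<lambda>_. 0) = 0"
      by (simp add: basis_mult_def)
    then show "0 \<in> basis_range Phi F"
      unfolding basis_range_def by (metis rangeI)
  next
    fix x y assume "x \<in> basis_range Phi F" "y \<in> basis_range Phi F"
    then obtain c d where "x = basis_mult Phi F c" "y = basis_mult Phi F d"
      by (auto simp: basis_range_def)
    then have "x + y = basis_mult Phi F (\<lambda>k. c k + d k)"
      by (simp add: basis_mult_def scaleR_add_left sum.distrib)
    then show "x + y \<in> basis_range Phi F"
      by (simp add: basis_range_def)
  next
    fix a x assume "x \<in> basis_range Phi F"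
    then obtain c where "x = basis_mult Phi F c"
      by (auto simp: basis_range_def)
    then have "a *\<^sub>R x = basis_mult Phi F (\<lambda>k. a * c k)"
      by (simp add: basis_mult_def scaleR_sum_right)
    then show "a *\<^sub>R x \<in> basis_range Phi F"
      by (simp add: basis_range_def)
  qed
  ultimately show "span (basis_col Phi ` index_set F) \<subseteq> basis_range Phi F"
    by (rule span_minimal)
qed

text \<open>One refinement step, with \<open>S i\<close> in the role of the marked elements. The
  first conclusion restores the assumption on \<open>F\<close> for the next step.\<close>

lemma basis_range_partial_refinement:
  assumes tree: "refinement_tree Vs E"
    and F: "\<And>i. F i \<subseteq> Vs" and S: "\<And>i. S i \<subseteq> F i"
    and G: "\<And>i. G i = partial_refinement Vs E (F i) (S i)"
  shows "G i \<subseteq> Vs" "basis_range Phi F \<subseteq> basis_range Phi G"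
proof -
  show GVs: "G i \<subseteq> Vs" for i
    using F S tree_refinement_subset[OF tree] unfolding G partial_refinement_def by blast
  have "finite Vs"
    using tree by (simp add: refinement_tree_def rooted_tree_def)
  then have fin: "finite (index_set F)" "finite (index_set G)"
    using F GVs by (meson finite_index_set finite_subset)+
  have "basis_col Phi (i, U) \<in> span (basis_col Phi ` index_set G)" if U: "U \<in> F i" for i U
  proof (cases "U \<in> S i")
    case True
    \<comment> \<open>A marked \<open>U\<close> is replaced within the same index \<open>i\<close>,
      so all summands of its projection are columns of the new basis.\<close>
    have "basis_col Phi (i, W) \<in> span (basis_col Phi ` index_set G)"
      if "W \<in> tree_refinement Vs E U" for W
      using True that by (auto simp: index_set_def G partial_refinement_def intro!: span_base)
    then have "(\<Sum>W\<in>tree_refinement Vs E U. basis_col Phi (i, W))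
        \<in> span (basis_col Phi ` index_set G)"
      by (rule span_sum)
    moreover have "basis_col Phi (i, U) = (\<Sum>W\<in>tree_refinement Vs E U. basis_col Phi (i, W))"
      unfolding basis_col_def prod.case
      using F U by (intro orth_proj_tree_refinement[OF tree]) blast
    ultimately show ?thesis
      by metis
  next
    case False
    \<comment> \<open>An unmarked element stays in the frontier, and its column is kept
      unchanged.\<close>
    with U show ?thesis
      by (auto simp: index_set_def G partial_refinement_def intro!: span_base)
  qed
  then have "basis_col Phi ` index_set F \<subseteq> span (basis_col Phi ` index_set G)"
    by (auto simp: index_set_def)
  then show "basis_range Phi F \<subseteq> basis_range Phi G"
    by (simp add: basis_range_eq_span fin span_minimal)
qed

text \<open>If iteration \<open>Suc k\<close> is performed, then iteration \<open>k\<close> was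
  performed and did not stop, so its update rule applies. The existential over \<open>d\<close>
  hides the error indicators.\<close>

lemma algorithm_run_Suc:
  assumes "algorithm_run Vs E r g xbar Phi eps tol F0 F xhat yhat"
    and "performed r xbar Phi eps F xhat (Suc k)"
  shows "\<exists>d. \<forall>i. F (Suc k) i = partial_refinement Vs E (F k i) (marked d (F k) i)"
proof -
  have "performed r xbar Phi eps F xhat k" "\<not> norm (r (state xbar Phi F xhat k)) < eps"
    using assms(2) by (auto simp: performed_def)
  then show ?thesis
    using assms(1) unfolding algorithm_run_def Let_def by blast
qed

text \<open>This is the invariant of the run: all elements to be refined are vertices of the tree,
  so that \<open>basis_range_partial_refinement\<close> is applicable at each performed
  iteration.\<close>

lemma algorithm_run_subset:
  assumes "refinement_tree Vs E"
    and "\<And>i. F0 i \<subseteq> Vs"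
    and "algorithm_run Vs E r g xbar Phi eps tol F0 F xhat yhat"
    and "performed r xbar Phi eps F xhat k"
  shows "F k i \<subseteq> Vs"
  using assms(4)
proof (induction k arbitrary: i)
  case 0
  then show ?case
    using assms(2,3) by (simp add: algorithm_run_def)
next
  case (Suc k)
  obtain d where d: "\<And>i. F (Suc k) i = partial_refinement Vs E (F k i) (marked d (F k) i)"
    using algorithm_run_Suc[OF assms(3) Suc.prems] by blast
  have "F k j \<subseteq> Vs" for j
    using Suc by (simp add: performed_def)
  then show ?case
    by (rule basis_range_partial_refinement(1)[OF assms(1) _ _ d]) (auto simp: marked_def)
qed

theorem theorem5p5:
  fixes Vs :: "(real^'n) set set"
    and E :: "((real^'n) set \<times> (real^'n) set) set"
    and r :: "real^'n \<Rightarrow> real^'n"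
    and g :: "real^'n \<Rightarrow> real"
    and xbar :: "real^'n"
    and Phi :: "real^'p^'n"
    and eps tol :: real
    and F0 :: "'p \<Rightarrow> (real^'n) set set"
    and F :: "nat \<Rightarrow> 'p \<Rightarrow> (real^'n) set set"
    and xhat yhat :: "nat \<Rightarrow> 'p \<times> (real^'n) set \<Rightarrow> real"
  assumes "refinement_tree Vs E"
    and "twice_continuously_differentiable r"
    and "twice_continuously_differentiable g"
    and "rank Phi = CARD('p)"
    and "eps > 0"
    and "tol \<ge> 0"
    and "\<And>i. tree_frontier Vs (F0 i)"
    and "algorithm_run Vs E r g xbar Phi eps tol F0 F xhat yhat"
  shows "\<forall>i\<ge>1. performed r xbar Phi eps F xhat i \<longrightarrow>
           basis_range Phi (F (i - 1)) \<subseteq> basis_range Phi (F i)"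
proof (intro allI impI)
  fix i :: nat
  assume "i \<ge> 1" and perf: "performed r xbar Phi eps F xhat i"
  \<comment> \<open>Since \<open>i \<ge> 1\<close>, the truncated difference \<open>i - 1\<close> is
    the true predecessor \<open>k\<close>.\<close>
  then obtain k where i: "i = Suc k"
    by (cases i) auto
  obtain d where d: "\<And>j. F (Suc k) j = partial_refinement Vs E (F k j) (marked d (F k) j)"
    using algorithm_run_Suc[OF assms(8) perf[unfolded i]] by blast
  have "performed r xbar Phi eps F xhat k"
    using perf by (simp add: i performed_def)
  then have "F k j \<subseteq> Vs" for j
    using algorithm_run_subset[OF assms(1) _ assms(8)] assms(7) by (simp add: tree_frontier_def)
  then have "basis_range Phi (F k) \<subseteq> basis_range Phi (F (Suc k))"
    by (rule basis_range_partial_refinement(2)[OF assms(1) _ _ d]) (auto simp: marked_def)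
  then show "basis_range Phi (F (i - 1)) \<subseteq> basis_range Phi (F i)"
    by (simp add: i)
qed

end
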